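(* Let $k$ be a commutative ring of characteristic $0$, and let $d_h:k[Y^\infty]_h\to k[Y^\infty]_h$ be the $k$-linear map given on a graph $t^g\in (Y^n)^g$ by $$d_h(t^g)=\sum_{i=0}^{n}(-1)^{i+g_i}\;{}_i{\leftrightarrow}_{i+1}(t^g),$$ where $g_i$ is the number of loops of $t^g$ before the leaf $i$ and ${}_i{\leftrightarrow}_{i+1}$ is the contraction operator (all defined in the context). Then $d_h\circ d_h=0$.
   Context: Planar binary trees. $Y^n$ is the set of planar binary rooted trees with $n$ internal (trivalent) vertices ($n$ is called the order); such a tree has $n+1$ leaves, numbered $0,\dots,n$ from left to right. $Y^0=\{|\}$, where $|$ is the tree with a single edge and no vertex. Graphs with loops. A graph $t^g$ of order $n$ with $g$ loops is obtained from a tree $t\in Y^n$ by joining, for each of $g$ distinct indices $i\in\{0,\dots,n-1\}$, the consecutive leaves $i$ and $i+1$ by an additional edge (a loop). So it is encoded by a pair $(t,S)$ with $t\in Y^n$, $S\subseteq\{0,\dots,n-1\}$, $|S|=g$, where $i\in S$ means that leaves $i$ and $i+1$ are joined. The same leaf may be involved in two loops (i.e. $i,i+1\in S$ is allowed). $(Y^n)^g$ denotes the set of all such graphs of order $n$ with $g$ loops, and $k[Y^\infty]_h$ is the free $k$-module on $\bigcup_{n,g}(Y^n)^g$. Contraction operator. For $0\le i\le n$ and $t^g=(t,S)\in(Y^n)^g$, ${}_i{\leftrightarrow}_{i+1}(t^g)$ is the graph obtained by joining leaves $i$ and $i+1$ of $t$ by a new edge, i.e. ${}_i{\leftrightarrow}_{i+1}(t,S)=(t,S\cup\{i\})$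 if $i\le n-1$ and $i\notin S$; it is $0$ if leaves $i$ and $i+1$ are already joined to each other ($i\in S$) or if there is no leaf $i+1$ ($i=n$). Leaves keep their original numbering $0,\dots,n$ in $t$. The number of loops before leaf $i$ is $g_i=|\{j\in S: j<i\}|$. Thus $d_h$ maps $k[(Y^n)^g]$ to $k[(Y^n)^{g+1}]$. *)

theory Defs
  imports Complex_Main "HOL-Library.Tree" "HOL-Library.Poly_Mapping"
begin

section \<open>Planar binary trees with loops\<close>

text \<open>
  Planar binary rooted trees are unlabelled binary trees: \<^const>\<open>Node\<close> is a trivalent
  vertex, \<^const>\<open>Leaf\<close> is a leaf, and \<^const>\<open>Leaf\<close> on its own is the tree with a
  single edge. Thus \<^term>\<open>size t\<close> is the number of internal vertices, and the leaves of
  \<^term>\<open>t\<close> are numbered from 0 to \<^term>\<open>size t\<close>, left to right.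
\<close>

type_synonym pbtree = "unit tree"

text \<open>
  In a pair \<open>(t, S)\<close>, \<open>i \<in> S\<close> means that the leaves \<open>i\<close> and \<open>i + 1\<close> of \<open>t\<close> are joined by a
  loop. The type below is the union of all the sets of graphs of order \<open>n\<close> with \<open>g\<close> loops.
\<close>

typedef loop_graph = "{(t :: pbtree, S :: nat set). S \<subseteq> {0..<size t}}"
  by (rule exI[of _ "(Leaf, {})"]) simp

setup_lifting type_definition_loop_graph

lift_definition tree_of :: "loop_graph \<Rightarrow> pbtree" is fst .

lift_definition loops :: "loop_graph \<Rightarrow> nat set" is snd .

definition order :: "loop_graph \<Rightarrow> nat" where
  "order G = size (tree_of G)"

definition graphs :: "nat \<Rightarrow> nat \<Rightarrow> loop_graph set" where
  "graphs n g = {G. order G = n \<and> card (loops G) = g}"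

definition loops_before :: "nat \<Rightarrow> loop_graph \<Rightarrow> nat" where
  "loops_before i G = card {j \<in> loops G. j < i}"

text \<open>Only meaningful for \<open>i < order G\<close>; otherwise there is no leaf \<open>i + 1\<close>.\<close>

lift_definition add_loop :: "nat \<Rightarrow> loop_graph \<Rightarrow> loop_graph" is
  "\<lambda>i (t, S). (t, if i < size t then insert i S else S)"
  by (auto split: if_splits)

lemma tree_of_add_loop [simp]: "tree_of (add_loop i G) = tree_of G"
  by transfer auto

lemma order_add_loop [simp]: "order (add_loop i G) = order G"
  by (simp add: order_def)

lemma loops_add_loop [simp]: "i < order G \<Longrightarrow> loops (add_loop i G) = insert i (loops G)"
  unfolding order_def by transfer auto

lemma loops_subset: "loops G \<subseteq> {0..<order G}"
  unfolding order_def by transfer auto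

lemma finite_loops [simp]: "finite (loops G)"
  using loops_subset finite_subset by blast

lemma loop_graph_eqI: "tree_of G = tree_of H \<Longrightarrow> loops G = loops H \<Longrightarrow> G = H"
  by transfer auto


section \<open>The free module on the graphs\<close>

text \<open>
  The type \<open>loop_graph \<Rightarrow>\<^sub>0 'k\<close> of finitely supported functions is the free \<open>'k\<close>-module on all
  graphs; the basis element of a graph \<open>G\<close> is \<^term>\<open>Poly_Mapping.single G 1\<close>.
\<close>

definition smult :: "'k::comm_ring_1 \<Rightarrow> ('a \<Rightarrow>\<^sub>0 'k) \<Rightarrow> ('a \<Rightarrow>\<^sub>0 'k)" where
  "smult c p = Poly_Mapping.map ((*) c) p"

lemma lookup_smult [simp]: "Poly_Mapping.lookup (smult c p) x = c * Poly_Mapping.lookup p x"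
  unfolding smult_def by transfer (simp add: when_def)

lemma module_smult: "module (smult :: 'k::comm_ring_1 \<Rightarrow> ('a \<Rightarrow>\<^sub>0 'k) \<Rightarrow> _)"
  by unfold_locales (auto intro!: poly_mapping_eqI simp: lookup_add algebra_simps)

definition contract :: "nat \<Rightarrow> loop_graph \<Rightarrow> (loop_graph \<Rightarrow>\<^sub>0 'k::comm_ring_1)" where
  "contract i G =
     (if i < order G \<and> i \<notin> loops G then Poly_Mapping.single (add_loop i G) 1 else 0)"

definition d_h_graph :: "loop_graph \<Rightarrow> (loop_graph \<Rightarrow>\<^sub>0 'k::comm_ring_1)" where
  "d_h_graph G = (\<Sum>i = 0..order G. smult ((-1) ^ (i + loops_before i G)) (contract i G))"

definition d_h :: "(loop_graph \<Rightarrow>\<^sub>0 'k::comm_ring_1) \<Rightarrow> (loop_graph \<Rightarrow>\<^sub>0 'k)" where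
  "d_h p = (\<Sum>G \<in> Poly_Mapping.keys p. smult (Poly_Mapping.lookup p G) (d_h_graph G))"

lemma d_h_single: "d_h (Poly_Mapping.single G 1) = (d_h_graph G :: loop_graph \<Rightarrow>\<^sub>0 'k::comm_ring_1)"
  by (auto simp: d_h_def intro!: poly_mapping_eqI)

lemma d_h_superset:
  assumes "finite A" "Poly_Mapping.keys p \<subseteq> A"
  shows "d_h p = (\<Sum>G \<in> A. smult (Poly_Mapping.lookup p G) (d_h_graph G))"
  unfolding d_h_def
  by (rule sum.mono_neutral_left[OF assms])
     (auto intro!: poly_mapping_eqI simp: in_keys_iff)

lemma d_h_linear: "module_hom smult smult (d_h :: (loop_graph \<Rightarrow>\<^sub>0 'k::comm_ring_1) \<Rightarrow> _)"
proof -
  interpret M: module "smult :: 'k \<Rightarrow> (loop_graph \<Rightarrow>\<^sub>0 'k) \<Rightarrow> _" by (rule module_smult)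
  show ?thesis
  proof unfold_locales
    fix p q :: "loop_graph \<Rightarrow>\<^sub>0 'k"
    let ?A = "Poly_Mapping.keys p \<union> Poly_Mapping.keys q"
    have "Poly_Mapping.keys (p + q) \<subseteq> ?A" by (rule keys_add)
    then show "d_h (p + q) = d_h p + d_h q"
      by (simp add: d_h_superset[of ?A] lookup_add M.scale_left_distrib sum.distrib)
  next
    fix c and p :: "loop_graph \<Rightarrow>\<^sub>0 'k"
    have "Poly_Mapping.keys (smult c p) \<subseteq> Poly_Mapping.keys p" by (auto simp: in_keys_iff)
    then show "d_h (smult c p) = smult c (d_h p)"
      by (simp add: d_h_superset[of "Poly_Mapping.keys p"] M.scale_sum_right)
  qed
qed

lemma d_h_degree:
  assumes "Poly_Mapping.keys p \<subseteq> graphs n g"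
  shows "Poly_Mapping.keys (d_h p :: loop_graph \<Rightarrow>\<^sub>0 'k::comm_ring_1) \<subseteq> graphs n (Suc g)"
proof
  fix H assume "H \<in> Poly_Mapping.keys (d_h p)"
  then have "(\<Sum>G \<in> Poly_Mapping.keys p. Poly_Mapping.lookup p G *
      Poly_Mapping.lookup (d_h_graph G) H) \<noteq> 0"
    by (simp add: in_keys_iff d_h_def lookup_sum)
  then obtain G where G: "G \<in> Poly_Mapping.keys p"
    and nz: "Poly_Mapping.lookup (d_h_graph G :: loop_graph \<Rightarrow>\<^sub>0 'k) H \<noteq> 0"
    by (metis (no_types, lifting) mult_zero_right sum.neutral)
  from nz obtain i where "Poly_Mapping.lookup (contract i G :: loop_graph \<Rightarrow>\<^sub>0 'k) H \<noteq> 0"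
    unfolding d_h_graph_def lookup_sum lookup_smult
    by (metis (no_types, lifting) mult_zero_right sum.neutral)
  then have "i < order G" "i \<notin> loops G" "H = add_loop i G"
    by (auto simp: contract_def lookup_single when_def split: if_splits)
  with G assms show "H \<in> graphs n (Suc g)"
    by (auto simp: graphs_def)
qed

end

theory Submission
  imports Defs
begin

text \<open>
  Applying \<^term>\<open>d_h\<close> twice to a graph adds two distinct loops \<open>i\<close> and \<open>j\<close>, in either
  order, and both orders produce the same graph. The signs are opposite: if \<open>i < j\<close>, a loop
  at \<open>i\<close> that is added first is counted among the loops before \<open>j\<close>, whereas a loop at \<open>j\<close>
  never contributes to the number of loops before \<open>i\<close>. So exactly one of the two orders picks
  up an extra factor \<open>-1\<close> (\<open>twice_contracted_swap\<close>), and the double sum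
  that gives \<^term>\<open>d_h (d_h_graph G)\<close> is a sum over all pairs of an alternating function of the
  two indices, hence zero (\<open>sum_alternating_eq_0\<close>). Linearity carries
  this from basis elements to the whole free module.
\<close>

text \<open>
  Each unordered pair contributes two terms that cancel. The hypothesis on the diagonal cannot
  be derived from antisymmetry, since \<open>2 * x = 0\<close> need not force \<open>x = 0\<close>.
\<close>
lemma sum_alternating_eq_0:
  fixes f :: "'a \<Rightarrow> 'a \<Rightarrow> 'b::ab_group_add"
  assumes "finite A"
    and diag: "\<And>x. f x x = 0"
    and anti: "\<And>x y. f y x = - f x y"
  shows "(\<Sum>x\<in>A. \<Sum>y\<in>A. f x y) = 0"
  using assms(1)
proof (induction A rule: finite_induct)
  case (insert a A)
  have "(\<Sum>x\<in>A. f x a) = - (\<Sum>y\<in>A. f a y)"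
    unfolding sum_negf[symmetric] by (rule sum.cong[OF refl]) (rule anti)
  with insert show ?case
    by (simp add: sum.distrib diag)
qed simp

lemma add_loop_commute:
  "i < order G \<Longrightarrow> j < order G \<Longrightarrow> add_loop j (add_loop i G) = add_loop i (add_loop j G)"
  by (rule loop_graph_eqI) (auto simp: insert_commute)

lemma loops_before_add_loop:
  assumes "i < order G" "i \<notin> loops G"
  shows "loops_before j (add_loop i G) = loops_before j G + (if i < j then 1 else 0)"
proof -
  have "{l \<in> insert i (loops G). l < j} =
      (if i < j then insert i {l \<in> loops G. l < j} else {l \<in> loops G. l < j})"
    by auto
  with assms show ?thesis
    by (simp add: loops_before_def)
qed

definition loop_sign :: "nat \<Rightarrow> loop_graph \<Rightarrow> 'k::comm_ring_1" where
  "loop_sign i G = (-1) ^ (i + loops_before i G)"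

lemma loop_sign_add_loop:
  assumes "i < order G" "i \<notin> loops G"
  shows "loop_sign j (add_loop i G) = (if i < j then - loop_sign j G else loop_sign j G)"
  using assms by (simp add: loop_sign_def loops_before_add_loop)

lemma d_h_graph_eq:
  "d_h_graph G = (\<Sum>i<order G. smult (loop_sign i G) (contract i G))"
proof -
  \<comment> \<open>The rightmost leaf has no right neighbour, so the last summand vanishes.\<close>
  have "smult c (contract (order G) G) = (0 :: loop_graph \<Rightarrow>\<^sub>0 'k::comm_ring_1)" for c
    by (auto intro!: poly_mapping_eqI simp: contract_def)
  then show ?thesis
    by (simp add: d_h_graph_def loop_sign_def atLeast0AtMost lessThan_Suc_atMost[symmetric])
qed

text \<open>The contribution to \<^term>\<open>d_h (d_h_graph G)\<close> of joining at \<open>i\<close> and then at \<open>j\<close>.\<close>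
definition twice_contracted :: "loop_graph \<Rightarrow> nat \<Rightarrow> nat \<Rightarrow> loop_graph \<Rightarrow>\<^sub>0 'k::comm_ring_1" where
  "twice_contracted G i j =
     (if i < order G \<and> i \<notin> loops G then
        smult (loop_sign i G * loop_sign j (add_loop i G)) (contract j (add_loop i G))
      else 0)"

lemma twice_contracted_diag: "twice_contracted G i i = 0"
  by (auto intro!: poly_mapping_eqI simp: twice_contracted_def contract_def)

lemma twice_contracted_swap:
  "twice_contracted G j i = - (twice_contracted G i j :: loop_graph \<Rightarrow>\<^sub>0 'k::comm_ring_1)"
proof (cases "i \<noteq> j \<and> {i, j} \<subseteq> {..<order G} - loops G")
  case True
  then have "i < j \<or> j < i"
    by auto
  with True show ?thesis
    by (intro poly_mapping_eqI)
      (auto simp: twice_contracted_def contract_def loop_sign_add_loop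
        add_loop_commute[of i G j] ac_simps)
next
  case False
  \<comment> \<open>The second contraction vanishes as soon as one of the two joins is impossible in \<open>G\<close>.\<close>
  then have "twice_contracted G i j = (0 :: loop_graph \<Rightarrow>\<^sub>0 'k)"
    and "twice_contracted G j i = (0 :: loop_graph \<Rightarrow>\<^sub>0 'k)"
    by (auto intro!: poly_mapping_eqI simp: twice_contracted_def contract_def)
  then show ?thesis
    by simp
qed

lemma d_h_d_h_graph: "d_h (d_h_graph G) = (0 :: loop_graph \<Rightarrow>\<^sub>0 'k::comm_ring_1)"
proof -
  interpret D: module_hom smult smult "d_h :: (loop_graph \<Rightarrow>\<^sub>0 'k) \<Rightarrow> _"
    by (rule d_h_linear)
  have expand: "smult (loop_sign i G) (d_h (contract i G)) =
      (\<Sum>j<order G. twice_contracted G i j :: loop_graph \<Rightarrow>\<^sub>0 'k)" for i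
    by (auto simp: contract_def d_h_single d_h_graph_eq twice_contracted_def
        D.m1.scale_sum_right)
  have "d_h (d_h_graph G) = (\<Sum>i<order G. \<Sum>j<order G. twice_contracted G i j :: loop_graph \<Rightarrow>\<^sub>0 'k)"
    by (simp add: d_h_graph_eq[of G] D.sum D.scale expand)
  also have "\<dots> = 0"
    by (rule sum_alternating_eq_0) (rule finite_lessThan twice_contracted_diag twice_contracted_swap)+
  finally show ?thesis .
qed

theorem lemma2:
  shows "d_h \<circ> d_h = (\<lambda>_ :: loop_graph \<Rightarrow>\<^sub>0 'k::{comm_ring_1, ring_char_0}. 0)"
proof
  fix p :: "loop_graph \<Rightarrow>\<^sub>0 'k"
  interpret D: module_hom smult smult "d_h :: (loop_graph \<Rightarrow>\<^sub>0 'k) \<Rightarrow> _"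
    by (rule d_h_linear)
  have "d_h (d_h p) = (\<Sum>G\<in>Poly_Mapping.keys p. smult (Poly_Mapping.lookup p G) (d_h (d_h_graph G)))"
    unfolding d_h_def[of p] by (simp add: D.sum D.scale)
  then show "(d_h \<circ> d_h) p = 0"
    by (simp add: d_h_d_h_graph)
qed

end
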